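(* Let $\mathbb{T}$ be a time scale with $0\in\mathbb{T}$ and let $\alpha:\mathbb{T}\to\mathbb{C}$ be regressive and rd-continuous. The Cayley-hyperbolic functions satisfy $$\mathrm{Cosh}_\alpha^2(t)-\mathrm{Sinh}_\alpha^2(t)=1\qquad(t\in\mathbb{T})$$ and $$\mathrm{Cosh}_\alpha^\Delta(t)=\alpha(t)\,\langle\mathrm{Sinh}_\alpha(t)\rangle,\qquad \mathrm{Sinh}_\alpha^\Delta(t)=\alpha(t)\,\langle\mathrm{Cosh}_\alpha(t)\rangle\qquad(t\in\mathbb{T}^\kappa),$$ where $\langle x(t)\rangle:=\frac{x(t)+x(\sigma(t))}{2}$.
   Context: A time scale $\mathbb{T}$ is a nonempty closed subset of $\mathbb{R}$. Forward jump: $\sigma(t)=\inf\{s\in\mathbb{T}:s>t\}$ (with $\inf\emptyset=\sup\mathbb{T}$). A point $t$ is right-dense if $\sigma(t)=t$, right-scattered if $\sigma(t)>t$; left-dense/left-scattered are defined analogously with the backward jump operator. $\mathbb{T}^\kappa$ is $\mathbb{T}$ minus its left-scattered maximum if that exists, and $\mathbb{T}^\kappa=\mathbb{T}$ otherwise. Graininess: $\mu(t)=\sigma(t)-t$. A function is rd-continuous if it is continuous at right-dense points and has finite left-hand limits at left-dense points. The delta derivative at $t\in\mathbb{T}^\kappa$ is $f^\Delta(t)=\lim_{s\to t,\,s\neq\sigma(t)}\frac{f(\sigma(t))-f(s)}{\sigma(t)-s}$ ($s\in\mathbb{T}$, $s=t$ allowed when $t\ne\sigma(t)$). The delta integral is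 $\int_{t_0}^t f(s)\,\Delta s=F(t)-F(t_0)$ where $F^\Delta=f$ on $\mathbb{T}^\kappa$; it exists for rd-continuous $f$. A function $\alpha:\mathbb{T}\to\mathbb{C}$ is regressive if $\mu(t)\alpha(t)\neq\pm2$ for all $t\in\mathbb{T}^\kappa$. With $\log$ the principal branch of the complex logarithm, $\zeta_h(z)=\frac1h\log\frac{1+\frac12zh}{1-\frac12zh}$ for $h>0$ and $\zeta_0(z)=z$. For rd-continuous regressive $\alpha$, $E_\alpha(t)=\exp\left(\int_{0}^t\zeta_{\mu(s)}(\alpha(s))\,\Delta s\right)$, and the Cayley-hyperbolic functions are $\mathrm{Cosh}_\alpha(t)=\frac{E_\alpha(t)+E_{-\alpha}(t)}2$, $\mathrm{Sinh}_\alpha(t)=\frac{E_\alpha(t)-E_{-\alpha}(t)}2$. *)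

theory Defs
  imports "HOL-Analysis.Analysis"
begin

text \<open>
  Functions on a time scale \<open>T\<close> are total functions on the reals; all notions below, when used
  at points of \<open>T\<close>, depend only on the values taken on \<open>T\<close>.
\<close>

definition time_scale :: "real set \<Rightarrow> bool" where
  "time_scale T \<longleftrightarrow> T \<noteq> {} \<and> closed T"

text \<open>
  The value \<open>Sup T\<close> (resp. \<open>Inf T\<close>) is only reached for \<open>t \<in> T\<close> when \<open>t\<close> is the maximum
  (resp. minimum) of \<open>T\<close>, so the supremum (infimum) is then that of a bounded set.  In particular
  a maximum of \<open>T\<close> counts as right-dense and a minimum as left-dense.
\<close>

definition forward_jump :: "real set \<Rightarrow> real \<Rightarrow> real" where
  "forward_jump T t = (if {s \<in> T. s > t} = {} then Sup T else Inf {s \<in> T. s > t})"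

definition backward_jump :: "real set \<Rightarrow> real \<Rightarrow> real" where
  "backward_jump T t = (if {s \<in> T. s < t} = {} then Inf T else Sup {s \<in> T. s < t})"

definition graininess :: "real set \<Rightarrow> real \<Rightarrow> real" where
  "graininess T t = forward_jump T t - t"

definition right_dense :: "real set \<Rightarrow> real \<Rightarrow> bool" where
  "right_dense T t \<longleftrightarrow> forward_jump T t = t"

definition left_dense :: "real set \<Rightarrow> real \<Rightarrow> bool" where
  "left_dense T t \<longleftrightarrow> backward_jump T t = t"

definition left_scattered :: "real set \<Rightarrow> real \<Rightarrow> bool" where
  "left_scattered T t \<longleftrightarrow> backward_jump T t < t"

definition kappa :: "real set \<Rightarrow> real set" where
  "kappa T = T - {m \<in> T. (\<forall>s\<in>T. s \<le> m) \<and> left_scattered T m}"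

definition rd_continuous :: "real set \<Rightarrow> (real \<Rightarrow> complex) \<Rightarrow> bool" where
  "rd_continuous T f \<longleftrightarrow>
     (\<forall>t\<in>T. right_dense T t \<longrightarrow> continuous (at t within T) f) \<and>
     (\<forall>t\<in>T. left_dense T t \<longrightarrow> (\<exists>l. (f \<longlongrightarrow> l) (at t within T \<inter> {..<t})))"

text \<open>
  The variable \<open>s\<close> ranges over \<open>T - {\<sigma>(t)}\<close> near \<open>t\<close>; unlike with \<^term>\<open>at t within T\<close>, the
  value \<open>s = t\<close> is allowed when \<open>t \<noteq> \<sigma>(t)\<close>.
\<close>

definition has_delta_derivative ::
    "real set \<Rightarrow> (real \<Rightarrow> complex) \<Rightarrow> complex \<Rightarrow> real \<Rightarrow> bool" where
  "has_delta_derivative T f D t \<longleftrightarrow>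
     ((\<lambda>s. (f (forward_jump T t) - f s) / complex_of_real (forward_jump T t - s)) \<longlongrightarrow> D)
       (inf (nhds t) (principal (T - {forward_jump T t})))"

definition delta_antiderivative ::
    "real set \<Rightarrow> (real \<Rightarrow> complex) \<Rightarrow> (real \<Rightarrow> complex) \<Rightarrow> bool" where
  "delta_antiderivative T f F \<longleftrightarrow> (\<forall>t\<in>kappa T. has_delta_derivative T F (f t) t)"

definition delta_integral :: "real set \<Rightarrow> (real \<Rightarrow> complex) \<Rightarrow> real \<Rightarrow> real \<Rightarrow> complex" where
  "delta_integral T f a b = (THE I. \<exists>F. delta_antiderivative T f F \<and> I = F b - F a)"

definition regressive :: "real set \<Rightarrow> (real \<Rightarrow> complex) \<Rightarrow> bool" where
  "regressive T \<alpha> \<longleftrightarrow>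
     (\<forall>t\<in>kappa T. complex_of_real (graininess T t) * \<alpha> t \<noteq> 2 \<and>
                   complex_of_real (graininess T t) * \<alpha> t \<noteq> - 2)"

definition cayley_zeta :: "real \<Rightarrow> complex \<Rightarrow> complex" where
  "cayley_zeta h z =
     (if h = 0 then z
      else 1 / complex_of_real h *
           Ln ((1 + 1/2 * z * complex_of_real h) / (1 - 1/2 * z * complex_of_real h)))"

definition cayley_exp :: "real set \<Rightarrow> (real \<Rightarrow> complex) \<Rightarrow> real \<Rightarrow> complex" where
  "cayley_exp T \<alpha> t = exp (delta_integral T (\<lambda>s. cayley_zeta (graininess T s) (\<alpha> s)) 0 t)"

definition cayley_cosh :: "real set \<Rightarrow> (real \<Rightarrow> complex) \<Rightarrow> real \<Rightarrow> complex" where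
  "cayley_cosh T \<alpha> t = (cayley_exp T \<alpha> t + cayley_exp T (\<lambda>s. - \<alpha> s) t) / 2"

definition cayley_sinh :: "real set \<Rightarrow> (real \<Rightarrow> complex) \<Rightarrow> real \<Rightarrow> complex" where
  "cayley_sinh T \<alpha> t = (cayley_exp T \<alpha> t - cayley_exp T (\<lambda>s. - \<alpha> s) t) / 2"

definition jump_average :: "real set \<Rightarrow> (real \<Rightarrow> complex) \<Rightarrow> real \<Rightarrow> complex" where
  "jump_average T x t = (x t + x (forward_jump T t)) / 2"

end

theory Submission
  imports Defs
begin

text \<open>
  The values \<open>E\<close> of \<^const>\<open>cayley_exp\<close> satisfy \<open>E\<^sup>\<Delta> = \<alpha> \<langle>E\<rangle>\<close>: where \<open>\<mu> = 0\<close> this is the chain rule, and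
  where \<open>\<mu> > 0\<close> the exponential of \<open>\<mu> \<zeta>\<^sub>\<mu>(\<alpha>)\<close> is \<open>(2 + \<mu>\<alpha>) / (2 - \<mu>\<alpha>)\<close>.  The differential
  identities for Cosh and Sinh follow by linearity.  Since \<open>(fg)\<^sup>\<Delta> = f\<^sup>\<Delta> \<langle>g\<rangle> + \<langle>f\<rangle> g\<^sup>\<Delta>\<close>, the product
  of the exponentials of \<open>\<alpha>\<close> and \<open>-\<alpha>\<close> has derivative zero, hence is constantly 1; this avoids
  comparing the branches of the logarithm in \<open>\<zeta>\<^sub>\<mu>(\<alpha>)\<close> and \<open>\<zeta>\<^sub>\<mu>(-\<alpha>)\<close>.

  The delta integral is meaningful because a function with zero delta derivative is constant
  (induction along the time scale) and because an rd-continuous function has an antiderivative: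
  extended to the reals as a step function across the gaps, it is regulated, and its ordinary
  integral restricts to an antiderivative.
\<close>

section \<open>Jump operators and induction\<close>

text \<open>The case \<open>max\<close> is the convention for the infimum of the empty set.
  Otherwise \<sigma>(t) is the infimum of a nonempty subset of the closed set T, so T contains
  it.\<close>

lemma forward_jump_cases:
  assumes T: "time_scale T" and t: "t \<in> T"
  obtains (max) "\<And>s. s \<in> T \<Longrightarrow> s \<le> t" "forward_jump T t = t"
  | (less) "forward_jump T t \<in> T" "t \<le> forward_jump T t"
      "\<And>s. s \<in> T \<Longrightarrow> t < s \<Longrightarrow> forward_jump T t \<le> s"
proof (cases "{s \<in> T. s > t} = {}")
  case True
  then have le: "\<And>s. s \<in> T \<Longrightarrow> s \<le> t" by force
  moreover have "forward_jump T t = t"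
    unfolding forward_jump_def using True le t by (auto intro!: cSup_eq_maximum)
  ultimately show thesis by (rule max)
next
  case False
  let ?S = "{s \<in> T. s > t}"
  have eq: "forward_jump T t = Inf ?S" unfolding forward_jump_def using False by (rule if_not_P)
  have bdd: "bdd_below ?S" by (rule bdd_belowI[of _ t]) auto
  have "Inf ?S \<in> closure ?S" using False bdd by (rule closure_contains_Inf)
  also have "closure ?S \<subseteq> T"
    using T by (intro closure_minimal) (auto simp: time_scale_def)
  finally have "forward_jump T t \<in> T" using eq by simp
  moreover have "t \<le> forward_jump T t"
    unfolding eq using False by (intro cInf_greatest) auto
  moreover have "\<And>s. s \<in> T \<Longrightarrow> t < s \<Longrightarrow> forward_jump T t \<le> s"
    unfolding eq using bdd by (intro cInf_lower) auto
  ultimately show thesis by (rule less)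
qed

lemma forward_jump_in: "time_scale T \<Longrightarrow> t \<in> T \<Longrightarrow> forward_jump T t \<in> T"
  by (metis forward_jump_cases)

lemma forward_jump_ge: "time_scale T \<Longrightarrow> t \<in> T \<Longrightarrow> t \<le> forward_jump T t"
  by (metis forward_jump_cases order_refl)

lemma forward_jump_le:
  "time_scale T \<Longrightarrow> t \<in> T \<Longrightarrow> s \<in> T \<Longrightarrow> t < s \<Longrightarrow> forward_jump T t \<le> s"
  by (metis forward_jump_cases not_less)

lemma right_denseI:
  assumes "time_scale T" "t \<in> T" "\<And>e. e > 0 \<Longrightarrow> \<exists>s\<in>T. t < s \<and> s < t + e"
  shows "right_dense T t"
proof (rule ccontr)
  assume "\<not> right_dense T t"
  then have "t < forward_jump T t"
    using forward_jump_ge[OF assms(1,2)] by (simp add: right_dense_def)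
  then obtain s where "s \<in> T" "t < s" "s < forward_jump T t"
    using assms(3)[of "forward_jump T t - t"] by auto
  then show False using forward_jump_le[OF assms(1,2)] by fastforce
qed

text \<open>The point s beyond t rules out a maximum of T, which counts as right-dense without being
  a limit from the right.\<close>

lemma right_dense_nearby:
  assumes T: "time_scale T" "t \<in> T" and d: "right_dense T t" and s: "s \<in> T" "t < s" and e: "e > 0"
  shows "\<exists>r\<in>T. t < r \<and> r < t + e"
proof (rule ccontr)
  assume no: "\<not> ?thesis"
  have "t + e \<le> Inf {s \<in> T. s > t}"
    using s no by (intro cInf_greatest) (auto simp: not_less)
  moreover have "forward_jump T t = Inf {s \<in> T. s > t}"
    using s by (auto simp: forward_jump_def)
  ultimately show False using d e by (simp add: right_dense_def)
qed

lemma left_denseI: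
  assumes "\<And>e. e > 0 \<Longrightarrow> \<exists>s\<in>T. t - e < s \<and> s < t"
  shows "left_dense T t"
proof -
  have ne: "{s \<in> T. s < t} \<noteq> {}" using assms[of 1] by auto
  have bdd: "bdd_above {s \<in> T. s < t}" by (rule bdd_aboveI[of _ t]) auto
  have "Sup {s \<in> T. s < t} \<le> t" using ne by (intro cSup_least) auto
  moreover have "\<not> Sup {s \<in> T. s < t} < t"
  proof
    assume "Sup {s \<in> T. s < t} < t"
    then obtain s where "s \<in> T" "Sup {s \<in> T. s < t} < s" "s < t"
      using assms[of "t - Sup {s \<in> T. s < t}"] by auto
    then show False using cSup_upper[OF _ bdd, of s] by auto
  qed
  ultimately show ?thesis unfolding left_dense_def backward_jump_def using ne by auto
qed

section \<open>The truncated time scale and induction along a time scale\<close>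

lemma kappa_subset: "kappa T \<subseteq> T"
  by (auto simp: kappa_def)

lemma kappa_not_max: "t \<in> T \<Longrightarrow> s \<in> T \<Longrightarrow> t < s \<Longrightarrow> t \<in> kappa T"
  by (force simp: kappa_def)

text \<open>Used in contrapositive form: a point of T that other points of T approach lies in
  \<open>kappa T\<close>, so derivatives are available at left limits.\<close>

lemma not_kappa_isolated:
  assumes t: "t \<in> T" "t \<notin> kappa T"
  shows "\<exists>e>0. \<forall>s\<in>T. \<bar>s - t\<bar> < e \<longrightarrow> s = t"
proof -
  have max: "\<And>s. s \<in> T \<Longrightarrow> s \<le> t" and sc: "left_scattered T t"
    using t by (auto simp: kappa_def)
  have "\<not> left_dense T t" using sc by (simp add: left_scattered_def left_dense_def)
  then obtain e where "e > 0" "\<not> (\<exists>s\<in>T. t - e < s \<and> s < t)"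
    using left_denseI by blast
  then show ?thesis using max by (intro exI[of _ e]) force
qed

text \<open>Let m be the infimum of the counterexamples; it lies in T because T is closed. P holds
  at m, reached either as a left limit or by a jump. To the right of m, \<open>dense_right\<close>
  or the jump from m keeps all counterexamples a fixed distance away, against the choice of
  m.\<close>

lemma time_scale_induct:
  assumes T: "time_scale T" and a: "a \<in> T" "P a" and b: "b \<in> T" "a \<le> b"
    and scattered: "\<And>t. t \<in> T \<Longrightarrow> a \<le> t \<Longrightarrow> t < forward_jump T t \<Longrightarrow> P t \<Longrightarrow> P (forward_jump T t)"
    and dense_right: "\<And>t. t \<in> T \<Longrightarrow> a \<le> t \<Longrightarrow> t < b \<Longrightarrow> right_dense T t \<Longrightarrow> P t \<Longrightarrow>
      \<exists>d>0. \<forall>s\<in>T. t < s \<and> s < t + d \<longrightarrow> P s"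
    and dense_left: "\<And>t. t \<in> T \<Longrightarrow> a < t \<Longrightarrow> (\<And>e. e > 0 \<Longrightarrow> \<exists>s\<in>T. t - e < s \<and> s < t) \<Longrightarrow>
      (\<And>s. s \<in> T \<Longrightarrow> a \<le> s \<Longrightarrow> s < t \<Longrightarrow> P s) \<Longrightarrow> P t"
  shows "P b"
proof (rule ccontr)
  assume nb: "\<not> P b"
  define N where "N = {t \<in> T. a \<le> t \<and> \<not> P t}"
  define m where "m = Inf N"
  have bN: "b \<in> N" using b nb by (simp add: N_def)
  have bdd: "bdd_below N" by (rule bdd_belowI[of _ a]) (auto simp: N_def)
  have am: "a \<le> m" unfolding m_def using bN by (intro cInf_greatest) (auto simp: N_def)
  have "m \<in> closure N" unfolding m_def using bN bdd by (intro closure_contains_Inf) auto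
  also have "closure N \<subseteq> T" using T by (intro closure_minimal) (auto simp: time_scale_def N_def)
  finally have mT: "m \<in> T" .
  have mle: "m \<le> t" if "t \<in> N" for t unfolding m_def using that bdd by (rule cInf_lower)
  have below: "P s" if "s \<in> T" "a \<le> s" "s < m" for s
    using mle[of s] that by (force simp: N_def)
  have Pm: "P m"
  proof (cases "m = a")
    case False
    then have "a < m" using am by simp
    show ?thesis
    proof (cases "\<forall>e>0. \<exists>s\<in>T. m - e < s \<and> s < m")
      case True
      then show ?thesis using dense_left[OF mT \<open>a < m\<close>] below by blast
    next
      case False
      then obtain e where e: "e > 0" "\<And>s. s \<in> T \<Longrightarrow> s < m \<Longrightarrow> s \<le> m - e" by force
      \<comment> \<open>r is the last point of T before m; once m = \<sigma>(r) is known,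
        \<open>scattered\<close> passes P from r to m.\<close>
      define r where "r = Sup {s \<in> T. s < m}"
      have ne: "{s \<in> T. s < m} \<noteq> {}" using a \<open>a < m\<close> by auto
      have bd: "bdd_above {s \<in> T. s < m}" by (rule bdd_aboveI[of _ m]) auto
      have "r \<in> closure {s \<in> T. s < m}" unfolding r_def using ne bd by (rule closure_contains_Sup)
      also have "\<dots> \<subseteq> T" using T by (intro closure_minimal) (auto simp: time_scale_def)
      finally have rT: "r \<in> T" .
      have "r \<le> m - e" unfolding r_def using ne e(2) by (intro cSup_least) auto
      then have rm: "r < m" using e by simp
      have up: "s \<le> r" if "s \<in> T" "s < m" for s
        unfolding r_def using bd that by (intro cSup_upper) auto
      have ar: "a \<le> r" using up a \<open>a < m\<close> by simp
      have "m = forward_jump T r"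
      proof (rule ccontr)
        assume "m \<noteq> forward_jump T r"
        then have lt: "forward_jump T r < m" using forward_jump_le[OF T rT mT rm] by simp
        then have "forward_jump T r \<le> r" using up forward_jump_in[OF T rT] by simp
        then have "right_dense T r"
          using forward_jump_ge[OF T rT] by (simp add: right_dense_def)
        then obtain q where "q \<in> T" "r < q" "q < r + (m - r)"
          using right_dense_nearby[OF T rT _ mT rm, of "m - r"] rm by auto
        then show False using up[of q] by simp
      qed
      then show ?thesis using scattered[OF rT ar] rm below[OF rT ar rm] by simp
    qed
  qed (use a in simp)
  have mN: "m \<notin> N" using Pm by (simp add: N_def)
  have mb: "m < b" using mle[OF bN] bN mN by (cases "m = b") auto
  have "\<exists>d>0. \<forall>s\<in>N. m + d \<le> s"
  proof (cases "right_dense T m")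
    case True
    then obtain d where d: "d > 0" "\<And>s. s \<in> T \<Longrightarrow> m < s \<Longrightarrow> s < m + d \<Longrightarrow> P s"
      using dense_right[OF mT am mb _ Pm] by blast
    have "m + d \<le> s" if "s \<in> N" for s
    proof (rule ccontr)
      assume "\<not> m + d \<le> s"
      moreover have "m < s" using that mle[OF that] mN by (cases "s = m") auto
      ultimately show False using that d(2)[of s] by (simp add: N_def)
    qed
    then show ?thesis using d by blast
  next
    case False
    then have "m < forward_jump T m"
      using forward_jump_ge[OF T mT] by (simp add: right_dense_def)
    moreover have "forward_jump T m \<le> s" if "s \<in> N" for s
      using forward_jump_le[OF T mT, of s] that mle[OF that] mN
      by (cases "s = m") (auto simp: N_def)
    ultimately show ?thesis by (intro exI[of _ "forward_jump T m - m"]) auto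
  qed
  then obtain d where "d > 0" "\<And>s. s \<in> N \<Longrightarrow> m + d \<le> s" by blast
  then have "m + d \<le> m" unfolding m_def using bN by (intro cInf_greatest) (auto simp: m_def)
  then show False using \<open>d > 0\<close> by simp
qed

section \<open>Delta derivatives\<close>

text \<open>With \<sigma>(t) = t the defining filter is the usual punctured one, and reversing both
  differences leaves the quotient unchanged.\<close>

lemma has_delta_derivative_right_dense:
  assumes "right_dense T t"
  shows "has_delta_derivative T f D t \<longleftrightarrow> (f has_vector_derivative D) (at t within T)"
proof -
  let ?q = "\<lambda>s. (f t - f s) / complex_of_real (t - s)"
  have "norm ((f s - f t) - (s - t) *\<^sub>R D) / norm (s - t) = norm (?q s - D)" if "s \<noteq> t" for s
  proof -
    have "?q s - D = ((f s - f t) - (s - t) *\<^sub>R D) / complex_of_real (s - t)"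
      using that by (simp add: scaleR_conv_of_real field_simps)
    then show ?thesis by (simp add: norm_divide flip: of_real_diff)
  qed
  then have "((\<lambda>s. norm ((f s - f t) - (s - t) *\<^sub>R D) / norm (s - t)) \<longlongrightarrow> 0) (at t within T) \<longleftrightarrow>
      ((\<lambda>s. norm (?q s - D)) \<longlongrightarrow> 0) (at t within T)"
    by (intro filterlim_cong) (auto simp: eventually_at_filter)
  then show ?thesis
    using assms unfolding has_delta_derivative_def right_dense_def
      has_vector_derivative_def has_derivative_iff_norm
    by (simp add: tendsto_norm_zero_iff LIM_zero_iff at_within_def bounded_linear_scaleR_left)
qed

lemma continuous_within_iff_tendsto_principal:
  fixes f :: "'a::t2_space \<Rightarrow> 'b::topological_space"
  assumes "t \<in> T"
  shows "continuous (at t within T) f \<longleftrightarrow> (f \<longlongrightarrow> f t) (inf (nhds t) (principal T))"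
  unfolding continuous_within by (rule tendsto_at_iff_tendsto_nhds_within) simp

text \<open>Near t the denominator stays away from 0, so the quotient converges exactly when f does;
  as s = t is allowed, the limit must be the value at t.\<close>

lemma has_delta_derivative_right_scattered:
  assumes t: "t \<in> T" and lt: "t < forward_jump T t"
  shows "has_delta_derivative T f D t \<longleftrightarrow> continuous (at t within T) f \<and>
    D = (f (forward_jump T t) - f t) / complex_of_real (forward_jump T t - t)"
proof -
  let ?\<sigma> = "forward_jump T t"
  let ?F = "inf (nhds t) (principal T)"
  have F: "inf (nhds t) (principal (T - {?\<sigma>})) = ?F"
  proof (rule filter_eqI)
    fix P
    have "eventually (\<lambda>s. s \<noteq> ?\<sigma>) (nhds t)" using lt by (intro t1_space_nhds) simp
    then show "eventually P (inf (nhds t) (principal (T - {?\<sigma>}))) \<longleftrightarrow> eventually P ?F"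
      unfolding eventually_inf_principal by (auto elim: eventually_elim2)
  qed
  have ev: "eventually (\<lambda>s. s \<noteq> ?\<sigma>) ?F"
    using lt by (intro filter_leD[OF inf_le1] t1_space_nhds) simp
  have id: "((\<lambda>s. s) \<longlongrightarrow> t) ?F"
    by (rule tendsto_mono[OF inf_le1]) (simp add: filterlim_def)
  \<comment> \<open>Here the admission of s = t enters: a limit along \<open>?F\<close> is also a
    limit along the single point t.\<close>
  have le: "principal {t} \<le> ?F"
    using t by (auto simp: le_filter_def eventually_principal eventually_inf_principal
        dest: eventually_nhds_x_imp_x)
  let ?q = "\<lambda>s. (f ?\<sigma> - f s) / complex_of_real (?\<sigma> - s)"
  have nz: "complex_of_real (?\<sigma> - t) \<noteq> 0" using lt by simp
  have "(?q \<longlongrightarrow> D) ?F \<longleftrightarrow> (f \<longlongrightarrow> f t) ?F \<and> D = ?q t"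
  proof
    assume q: "(?q \<longlongrightarrow> D) ?F"
    have "(?q \<longlongrightarrow> D) (principal {t})" using le q by (rule tendsto_mono)
    then have D: "D = ?q t"
      by (auto simp: tendsto_def eventually_principal dest: t1_space)
    \<comment> \<open>Solving the quotient for \<open>f s\<close> recovers the limit of f.\<close>
    have "((\<lambda>s. f ?\<sigma> - ?q s * complex_of_real (?\<sigma> - s)) \<longlongrightarrow> f ?\<sigma> - D * complex_of_real (?\<sigma> - t)) ?F"
      by (intro tendsto_intros q id)
    also have "f ?\<sigma> - D * complex_of_real (?\<sigma> - t) = f t" using D nz by simp
    finally have "(f \<longlongrightarrow> f t) ?F"
      by (rule Lim_transform_eventually) (rule eventually_mono[OF ev], simp)
    with D show "(f \<longlongrightarrow> f t) ?F \<and> D = ?q t" by simp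
  next
    assume "(f \<longlongrightarrow> f t) ?F \<and> D = ?q t"
    then show "(?q \<longlongrightarrow> D) ?F" using nz by (auto intro!: tendsto_intros id)
  qed
  then show ?thesis
    unfolding has_delta_derivative_def F continuous_within_iff_tendsto_principal[OF t] by simp
qed

lemma right_dense_or_scattered:
  assumes "time_scale T" "t \<in> T"
  shows "right_dense T t \<or> t < forward_jump T t"
  using forward_jump_ge[OF assms] by (auto simp: right_dense_def)

lemma has_delta_derivative_continuous:
  assumes "time_scale T" "t \<in> T" "has_delta_derivative T f D t"
  shows "continuous (at t within T) f"
  using right_dense_or_scattered[OF assms(1,2)] assms(2,3)
  by (auto simp: has_delta_derivative_right_dense has_delta_derivative_right_scattered
      intro: has_vector_derivative_continuous)

lemma has_delta_derivative_cmult: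
  assumes "has_delta_derivative T f D t"
  shows "has_delta_derivative T (\<lambda>s. c * f s) (c * D) t"
  using tendsto_mult_left[OF assms[unfolded has_delta_derivative_def], of c]
  unfolding has_delta_derivative_def by (simp only: right_diff_distrib times_divide_eq_right)

lemma has_delta_derivative_add:
  assumes "has_delta_derivative T f D t" "has_delta_derivative T g E t"
  shows "has_delta_derivative T (\<lambda>s. f s + g s) (D + E) t"
  using tendsto_add[OF assms[unfolded has_delta_derivative_def]]
  unfolding has_delta_derivative_def add_divide_distrib[symmetric] add_diff_add .

lemma has_delta_derivative_diff:
  assumes "has_delta_derivative T f D t" "has_delta_derivative T g E t"
  shows "has_delta_derivative T (\<lambda>s. f s - g s) (D - E) t"
  using has_delta_derivative_add[OF assms(1) has_delta_derivative_cmult[OF assms(2), of "- 1"]]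
  by simp

lemma has_delta_derivative_cong:
  assumes T: "time_scale T" "t \<in> T" and eq: "\<And>s. s \<in> T \<Longrightarrow> f s = g s"
    and f: "has_delta_derivative T f D t"
  shows "has_delta_derivative T g D t"
  using f unfolding has_delta_derivative_def
  by (rule Lim_transform_eventually)
    (auto simp: eventually_inf_principal eq forward_jump_in[OF T])

section \<open>Vanishing derivatives and uniqueness of the delta integral\<close>

text \<open>
  At a left-dense, right-scattered point the derivative says nothing about slopes from the left;
  there the bound is carried over by continuity alone.
\<close>

lemma delta_derivative_zero_imp_eq_le:
  assumes T: "time_scale T" and ab: "a \<in> T" "b \<in> T" "a \<le> b"
    and D: "\<And>t. t \<in> kappa T \<Longrightarrow> has_delta_derivative T F 0 t"
  shows "F a = F b"
proof -
  \<comment> \<open>A positive slope e is needed in place of 0: at right-dense points the zero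
    derivative controls increments only up to a small multiple of the step.\<close>
  have bound: "norm (F b - F a) \<le> e * (b - a)" if e: "e > 0" for e
  proof (rule time_scale_induct[OF T ab(1) _ ab(2,3), where P = "\<lambda>t. norm (F t - F a) \<le> e * (t - a)"])
    fix t assume t: "t \<in> T" "a \<le> t" "t < forward_jump T t" "norm (F t - F a) \<le> e * (t - a)"
    have "has_delta_derivative T F 0 t"
      using t forward_jump_in[OF T t(1)] by (intro D kappa_not_max)
    then have "F (forward_jump T t) = F t"
      using has_delta_derivative_right_scattered[OF t(1,3), of F 0] t(3) by simp
    moreover have "e * (t - a) \<le> e * (forward_jump T t - a)" using t e by simp
    ultimately show "norm (F (forward_jump T t) - F a) \<le> e * (forward_jump T t - a)"
      using t by simp
  next
    fix t assume t: "t \<in> T" "a \<le> t" "t < b" "right_dense T t" "norm (F t - F a) \<le> e * (t - a)"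
    have "(F has_vector_derivative 0) (at t within T)"
      using D[OF kappa_not_max[OF t(1) ab(2) t(3)]] has_delta_derivative_right_dense[OF t(4)] by simp
    then obtain d where d: "d > 0"
      "\<And>s. s \<in> T \<Longrightarrow> norm (s - t) < d \<Longrightarrow> norm (F s - F t) \<le> e * norm (s - t)"
      unfolding has_vector_derivative_def has_derivative_within_alt using e by auto
    have "norm (F s - F a) \<le> e * (s - a)" if s: "s \<in> T" "t < s" "s < t + d" for s
    proof -
      have "norm (F s - F a) \<le> norm (F s - F t) + norm (F t - F a)"
        using norm_triangle_ineq[of "F s - F t" "F t - F a"] by simp
      also have "\<dots> \<le> e * (s - t) + e * (t - a)"
        using d(2)[of s] s t by (intro add_mono) auto
      finally show ?thesis by (simp add: algebra_simps)
    qed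
    then show "\<exists>d>0. \<forall>s\<in>T. t < s \<and> s < t + d \<longrightarrow> norm (F s - F a) \<le> e * (s - a)"
      using d(1) by blast
  next
    fix t assume t: "t \<in> T" "a < t" and ex: "\<And>e. e > 0 \<Longrightarrow> \<exists>s\<in>T. t - e < s \<and> s < t"
      and IH: "\<And>s. s \<in> T \<Longrightarrow> a \<le> s \<Longrightarrow> s < t \<Longrightarrow> norm (F s - F a) \<le> e * (s - a)"
    have tk: "t \<in> kappa T"
    proof (rule ccontr)
      assume "t \<notin> kappa T"
      then obtain e where "e > 0" "\<forall>s\<in>T. \<bar>s - t\<bar> < e \<longrightarrow> s = t"
        using not_kappa_isolated[OF t(1)] by blast
      then show False using ex[of e] by force
    qed
    let ?L = "at t within (T \<inter> {..<t})"
    have ntriv: "?L \<noteq> bot"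
      unfolding trivial_limit_within islimpt_approachable
    proof (simp only: not_not, intro allI impI)
      fix e :: real assume "0 < e"
      then show "\<exists>x'\<in>T \<inter> {..<t}. x' \<noteq> t \<and> dist x' t < e"
        using ex[of e] by (force simp: dist_real_def)
    qed
    have "(F \<longlongrightarrow> F t) (at t within T)"
      using has_delta_derivative_continuous[OF T t(1) D[OF tk]] by (simp add: continuous_within)
    then have "(F \<longlongrightarrow> F t) ?L" by (rule tendsto_within_subset) auto
    then have lim: "((\<lambda>s. norm (F s - F a)) \<longlongrightarrow> norm (F t - F a)) ?L" by (intro tendsto_intros)
    have lim2: "((\<lambda>s. e * (s - a)) \<longlongrightarrow> e * (t - a)) ?L" by (intro tendsto_intros)
    have "eventually (\<lambda>s. a < s) (at t)" using t(2) by (intro order_tendstoD(1)[OF tendsto_ident_at])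
    then have "eventually (\<lambda>s. a < s) ?L" by (rule filter_leD[OF at_le, rotated]) auto
    moreover have "eventually (\<lambda>s. s \<in> T \<inter> {..<t}) ?L" by (simp add: eventually_at_filter)
    ultimately have "eventually (\<lambda>s. norm (F s - F a) \<le> e * (s - a)) ?L"
      by eventually_elim (auto intro: IH)
    then show "norm (F t - F a) \<le> e * (t - a)" by (rule tendsto_le[OF ntriv lim2 lim])
  qed simp
  have "norm (F b - F a) \<le> 0 + r" if r: "r > 0" for r
  proof -
    \<comment> \<open>The summand 1 keeps the denominator positive when a = b.\<close>
    have "norm (F b - F a) \<le> r / (b - a + 1) * (b - a)"
      using ab(3) r by (intro bound divide_pos_pos) auto
    also have "\<dots> \<le> r" using ab(3) r by (simp add: field_simps)
    finally show ?thesis by simp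
  qed
  then have "norm (F b - F a) \<le> 0" by (rule field_le_epsilon)
  then show ?thesis by simp
qed

lemma delta_derivative_zero_imp_eq:
  assumes "time_scale T" "a \<in> T" "b \<in> T" "\<And>t. t \<in> kappa T \<Longrightarrow> has_delta_derivative T F 0 t"
  shows "F a = F b"
proof (cases "a \<le> b")
  case True
  show ?thesis by (rule delta_derivative_zero_imp_eq_le[OF assms(1-3) True assms(4)])
next
  case False
  then have "b \<le> a" by simp
  show ?thesis
    by (rule delta_derivative_zero_imp_eq_le[OF assms(1,3,2) \<open>b \<le> a\<close> assms(4), symmetric])
qed

text \<open>Two antiderivatives differ by a constant on T, so the definite description in
  \<open>delta_integral\<close> has exactly one solution.\<close>

lemma delta_integral_eq:
  assumes T: "time_scale T" "a \<in> T" "b \<in> T" and F: "delta_antiderivative T f F"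
  shows "delta_integral T f a b = F b - F a"
  unfolding delta_integral_def
proof (rule the_equality)
  fix I assume "\<exists>G. delta_antiderivative T f G \<and> I = G b - G a"
  then obtain G where G: "delta_antiderivative T f G" and I: "I = G b - G a" by blast
  have "has_delta_derivative T (\<lambda>s. G s - F s) 0 t" if "t \<in> kappa T" for t
    using has_delta_derivative_diff[of T G "f t" t F "f t"] F G that
    by (simp add: delta_antiderivative_def)
  then have "G a - F a = G b - F b" by (rule delta_derivative_zero_imp_eq[OF T])
  then show "I = F b - F a" unfolding I by (simp add: algebra_simps)
qed (use F in blast)

section \<open>Existence of antiderivatives\<close>

text \<open>
  Below \<open>Inf T\<close> this is \<open>g (Sup {})\<close>, an unspecified constant; being constant there is all
  that is needed.
\<close>

definition step_extension :: "real set \<Rightarrow> (real \<Rightarrow> 'a) \<Rightarrow> real \<Rightarrow> 'a" where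
  "step_extension T g x = g (Sup (T \<inter> {..x}))"

lemma Sup_atMost_bounds:
  assumes T: "time_scale T" and s: "s \<in> T" "s \<le> x"
  shows "Sup (T \<inter> {..x}) \<in> T" "s \<le> Sup (T \<inter> {..x})" "Sup (T \<inter> {..x}) \<le> x"
proof -
  have ne: "T \<inter> {..x} \<noteq> {}" using s by auto
  have bdd: "bdd_above (T \<inter> {..x})" by (rule bdd_aboveI[of _ x]) auto
  have "Sup (T \<inter> {..x}) \<in> closure (T \<inter> {..x})" using ne bdd by (rule closure_contains_Sup)
  also have "\<dots> \<subseteq> T" using T by (intro closure_minimal) (auto simp: time_scale_def)
  finally show "Sup (T \<inter> {..x}) \<in> T" .
  show "s \<le> Sup (T \<inter> {..x})" using s bdd by (intro cSup_upper) auto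
  show "Sup (T \<inter> {..x}) \<le> x" using ne by (intro cSup_least) auto
qed

lemma step_extension_gap:
  assumes "\<And>s. s \<in> T \<Longrightarrow> x < s \<Longrightarrow> y < s" and "x \<le> y"
  shows "step_extension T g y = step_extension T g x"
proof -
  have "T \<inter> {..y} = T \<inter> {..x}" using assms by (force simp: not_less[symmetric])
  then show ?thesis by (simp add: step_extension_def)
qed

lemma step_extension_eq: "t \<in> T \<Longrightarrow> step_extension T g t = g t"
  unfolding step_extension_def by (subst cSup_eq_maximum[of t]) auto

section \<open>One-sided behaviour of the step extension\<close>

lemma islimpt_imp_mem: "time_scale T \<Longrightarrow> (\<And>e. e > 0 \<Longrightarrow> \<exists>s\<in>T. s \<noteq> x \<and> dist s x < e) \<Longrightarrow> x \<in> T"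
  unfolding time_scale_def closed_limpt islimpt_approachable by blast

lemma step_extension_left_regulated:
  assumes T: "time_scale T" and g: "rd_continuous T g" and e: "e > 0"
  shows "\<exists>l. \<exists>d>0. \<forall>y. x - d < y \<and> y < x \<longrightarrow> norm (step_extension T g y - l) \<le> e"
proof (cases "\<forall>d>0. \<exists>s\<in>T. x - d < s \<and> s < x")
  case True
  have xT: "x \<in> T"
    by (rule islimpt_imp_mem[OF T]) (use True in \<open>force simp: dist_real_def\<close>)
  have "left_dense T x" using True by (intro left_denseI) blast
  then obtain l where l: "(g \<longlongrightarrow> l) (at x within T \<inter> {..<x})"
    using g xT unfolding rd_continuous_def by blast
  obtain d where d: "d > 0"
    "\<forall>s\<in>T \<inter> {..<x}. s \<noteq> x \<and> dist s x < d \<longrightarrow> dist (g s) l < e"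
    using tendstoD[OF l e] unfolding eventually_at by blast
  \<comment> \<open>For y > s the anchor s in T forces the last point of T up to y into [s, y],
    where g is already near l.\<close>
  obtain s where s: "s \<in> T" "x - d < s" "s < x" using True d(1) by blast
  have "norm (step_extension T g y - l) \<le> e" if y: "s < y" "y < x" for y
  proof -
    let ?r = "Sup (T \<inter> {..y})"
    have "?r \<in> T" "s \<le> ?r" "?r \<le> y" using Sup_atMost_bounds[OF T s(1)] y by auto
    then have "dist (g ?r) l < e" using d(2) s y by (simp add: dist_real_def)
    then show ?thesis by (simp add: step_extension_def dist_norm)
  qed
  then show ?thesis using s(3) by (intro exI[of _ l] exI[of _ "x - s"]) auto
next
  case False
  then obtain d where d: "d > 0" "\<not> (\<exists>s\<in>T. x - d < s \<and> s < x)" by blast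
  \<comment> \<open>T misses the interval (x - d, x), so the extension is constant there; x - d/2
    serves as a sample point.\<close>
  have const: "step_extension T g y = step_extension T g (x - d / 2)"
    if "x - d < y" "y < x" for y
  proof (cases "y \<le> x - d / 2")
    case True
    show ?thesis
      by (rule step_extension_gap[symmetric, OF _ True]) (use d that in force)
  next
    case False
    then have "x - d / 2 \<le> y" by simp
    then show ?thesis by (rule step_extension_gap[rotated]) (use d that in force)
  qed
  have "norm (step_extension T g y - step_extension T g (x - d / 2)) \<le> e"
    if "x - d < y" "y < x" for y
    using const[OF that] e by simp
  then show ?thesis using d(1) by blast
qed

text \<open>To the left of x the estimate starts at a point s of T: if a gap of T ends at x, the
  extension just below x takes the value of g before the gap, which need not be near
  \<open>g x\<close>. Taking s = x gives the estimate on the right.\<close>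

lemma step_extension_near_right_dense:
  assumes T: "time_scale T" and g: "rd_continuous T g" and e: "e > 0"
    and x: "x \<in> T" "right_dense T x"
  shows "\<exists>d>0. \<forall>s\<in>T. s \<le> x \<and> x - d < s \<longrightarrow>
    (\<forall>y. s \<le> y \<and> y < x + d \<longrightarrow> norm (step_extension T g y - g x) \<le> e)"
proof -
  have "(g \<longlongrightarrow> g x) (at x within T)"
    using g x unfolding rd_continuous_def continuous_within by blast
  then obtain d where d: "d > 0" "\<And>s. s \<in> T \<Longrightarrow> s \<noteq> x \<Longrightarrow> dist s x < d \<Longrightarrow> dist (g s) (g x) < e"
    unfolding tendsto_iff eventually_at using e by fastforce
  have "norm (step_extension T g y - g x) \<le> e"
    if s: "s \<in> T" "s \<le> x" "x - d < s" and y: "s \<le> y" "y < x + d" for s y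
  proof (cases "Sup (T \<inter> {..y}) = x")
    case True
    then show ?thesis using e by (simp add: step_extension_def)
  next
    case False
    let ?r = "Sup (T \<inter> {..y})"
    have "?r \<in> T" "s \<le> ?r" "?r \<le> y" by (rule Sup_atMost_bounds[OF T s(1) y(1)])+
    then have "dist (g ?r) (g x) < e" using d(2) False s y by (simp add: dist_real_def abs_less_iff)
    then show ?thesis by (simp add: step_extension_def dist_norm)
  qed
  then show ?thesis using d(1) by blast
qed

lemma step_extension_right_regulated:
  assumes T: "time_scale T" and g: "rd_continuous T g" and e: "e > 0"
  shows "\<exists>l. \<exists>d>0. \<forall>y. x < y \<and> y < x + d \<longrightarrow> norm (step_extension T g y - l) \<le> e"
proof (cases "\<forall>d>0. \<exists>s\<in>T. x < s \<and> s < x + d")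
  case True
  have xT: "x \<in> T"
    by (rule islimpt_imp_mem[OF T]) (use True in \<open>force simp: dist_real_def\<close>)
  have "right_dense T x" using True by (intro right_denseI[OF T xT]) blast
  then obtain d where d: "d > 0" "\<forall>s\<in>T. s \<le> x \<and> x - d < s \<longrightarrow>
    (\<forall>y. s \<le> y \<and> y < x + d \<longrightarrow> norm (step_extension T g y - g x) \<le> e)"
    using step_extension_near_right_dense[OF T g e xT] by blast
  show ?thesis
    using d(1) d(2)[rule_format, OF xT] by (intro exI[of _ "g x"] exI[of _ d]) auto
next
  case False
  then obtain d where d: "d > 0" "\<not> (\<exists>s\<in>T. x < s \<and> s < x + d)" by blast
  have "step_extension T g y = step_extension T g x" if "x < y" "y < x + d" for y
    by (rule step_extension_gap) (use d that in force)+
  then show ?thesis using d e by (intro exI[of _ "step_extension T g x"] exI[of _ d]) auto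
qed

section \<open>Ordinary integrals of regulated functions\<close>

lemma regulated_integrable:
  fixes f :: "real \<Rightarrow> 'a::banach"
  assumes left: "\<And>x e. e > 0 \<Longrightarrow> \<exists>l. \<exists>d>0. \<forall>y. x - d < y \<and> y < x \<longrightarrow> norm (f y - l) \<le> e"
    and right: "\<And>x e. e > 0 \<Longrightarrow> \<exists>l. \<exists>d>0. \<forall>y. x < y \<and> y < x + d \<longrightarrow> norm (f y - l) \<le> e"
  shows "f integrable_on {a..b}"
proof (cases "a \<le> b")
  case True
  \<comment> \<open>Bisection reduces uniform approximation by integrable functions to short
    intervals around a point; integrability then passes to the uniform limit.\<close>
  have "\<exists>h. (\<forall>x\<in>{a..b}. norm (f x - h x) \<le> e) \<and> h integrable_on {a..b}" if e: "e > 0" for e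
    using True
  proof (induction rule: Bolzano)
    case (trans a b c)
    then obtain h1 h2 where h1: "\<forall>x\<in>{a..b}. norm (f x - h1 x) \<le> e" "h1 integrable_on {a..b}"
      and h2: "\<forall>x\<in>{b..c}. norm (f x - h2 x) \<le> e" "h2 integrable_on {b..c}" by blast
    let ?h = "\<lambda>x. if x \<le> b then h1 x else h2 x"
    have "?h integrable_on {a..b}"
      using h1(2) by (rule integrable_eq) simp
    moreover have "?h integrable_on {b..c}"
      using h2(2) by (rule integrable_spike[where S = "{b}"]) auto
    ultimately have "?h integrable_on {a..c}"
      by (rule Henstock_Kurzweil_Integration.integrable_combine[OF trans(3,4)])
    then show ?case using h1(1) h2(1) by (intro exI[of _ ?h]) auto
  next
    case (local x)
    obtain l d where l: "d > 0" "\<And>y. x - d < y \<Longrightarrow> y < x \<Longrightarrow> norm (f y - l) \<le> e"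
      using left[OF e, of x] by blast
    obtain l' d' where l': "d' > 0" "\<And>y. x < y \<Longrightarrow> y < x + d' \<Longrightarrow> norm (f y - l') \<le> e"
      using right[OF e, of x] by blast
    \<comment> \<open>On either side of x a constant is within e of f; at x itself the value of f is
      taken.\<close>
    let ?h = "\<lambda>y. if y < x then l else if y = x then f x else l'"
    have "\<exists>h. (\<forall>y\<in>{u..v}. norm (f y - h y) \<le> e) \<and> h integrable_on {u..v}"
      if uv: "u \<le> x" "x \<le> v" "v - u < min d d'" for u v
    proof (intro exI[of _ ?h] conjI ballI)
      fix y assume "y \<in> {u..v}"
      then show "norm (f y - ?h y) \<le> e"
        using l(2)[of y] l'(2)[of y] uv e by auto
    next
      have "?h integrable_on {u..x}"
        by (rule integrable_spike[of "\<lambda>_. l" _ "{x}"]) auto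
      moreover have "?h integrable_on {x..v}"
        by (rule integrable_spike[of "\<lambda>_. l'" _ "{x}"]) auto
      ultimately show "?h integrable_on {u..v}"
        by (rule Henstock_Kurzweil_Integration.integrable_combine[OF uv(1,2)])
    qed
    then show ?case using l(1) l'(1) by (intro exI[of _ "min d d'"]) auto
  qed
  then show ?thesis by (rule integrable_uniform_limit_real)
qed (simp add: integrable_on_empty)

lemma ex_indefinite_integral:
  fixes f :: "real \<Rightarrow> 'a::banach"
  assumes f: "\<And>a b. f integrable_on {a..b}"
  shows "\<exists>F. \<forall>a b. a \<le> b \<longrightarrow> F b - F a = integral {a..b} f"
proof -
  \<comment> \<open>The sign for x < 0 is that of the oriented integral from 0 to x, so one
    primitive serves the whole line.\<close>
  let ?F = "\<lambda>x. if 0 \<le> x then integral {0..x} f else - integral {x..0} f"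
  have comb: "integral {a..c} f + integral {c..b} f = integral {a..b} f" if "a \<le> c" "c \<le> b" for a b c
    by (rule Henstock_Kurzweil_Integration.integral_combine[OF that f])
  have "?F b - ?F a = integral {a..b} f" if ab: "a \<le> b" for a b
  proof -
    consider "0 \<le> a" | "a < 0" "0 \<le> b" | "b < 0" by linarith
    then show ?thesis
    proof cases
      case 1
      with comb[OF 1 ab] ab show ?thesis by (simp add: diff_eq_eq add.commute)
    next
      case 2
      with comb[of a 0 b] show ?thesis by (simp add: add.commute)
    next
      case 3
      with comb[OF ab, of 0] ab show ?thesis by (simp add: diff_eq_eq add.commute)
    qed
  qed
  then show ?thesis by (intro exI[of _ ?F] allI impI)
qed

text \<open>A primitive of the step extension works. Near a right-dense t the integrand is close to
  \<open>g t\<close> between t and nearby points of T; across a gap it is constantly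
  \<open>g t\<close>, so F grows by \<mu>(t) g(t).\<close>

lemma ex_delta_antiderivative:
  assumes T: "time_scale T" and g: "rd_continuous T g"
  shows "\<exists>F. delta_antiderivative T g F"
proof -
  let ?g = "step_extension T g"
  have int: "?g integrable_on {a..b}" for a b
    using step_extension_left_regulated[OF T g] step_extension_right_regulated[OF T g]
    by (rule regulated_integrable)
  then obtain F where F: "\<And>a b. a \<le> b \<Longrightarrow> F b - F a = integral {a..b} ?g"
    using ex_indefinite_integral[of ?g] by blast
  \<comment> \<open>At right-scattered points the derivative requires continuity of F besides the
    jump quotient.\<close>
  have cont: "isCont F t" for t
  proof -
    have "continuous_on {t - 1..t + 1} (\<lambda>x. F (t - 1) + integral {t - 1..x} ?g)"
      by (intro continuous_intros indefinite_integral_continuous_1 int)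
    then have "continuous_on {t - 1..t + 1} F"
      by (rule continuous_on_eq) (simp flip: F)
    then show ?thesis by (rule continuous_on_interior) simp
  qed
  \<comment> \<open>Mean value estimate, obtained by integrating \<open>?g y - c\<close>.\<close>
  have approx: "norm (F b - F a - (b - a) *\<^sub>R c) \<le> B * (b - a)"
    if "a \<le> b" "B \<ge> 0" and B: "\<And>y. a \<le> y \<Longrightarrow> y \<le> b \<Longrightarrow> norm (?g y - c) \<le> B" for a b c B
  proof -
    have "((\<lambda>y. ?g y - c) has_integral (F b - F a - (b - a) *\<^sub>R c)) {a..b}"
      unfolding F[OF that(1)]
      using has_integral_diff[OF integrable_integral[OF int] has_integral_const_real[of c a b]] that(1)
      by simp
    from has_integral_bound_real[OF that(2) finite.emptyI this] show ?thesis
      using B that(1) by simp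
  qed
  have "has_delta_derivative T F (g t) t" if t: "t \<in> T" for t
  proof (cases "right_dense T t")
    case True
    have "\<exists>d>0. \<forall>s\<in>T. norm (s - t) < d \<longrightarrow> norm (F s - F t - (s - t) *\<^sub>R g t) \<le> e * norm (s - t)"
      if e: "e > 0" for e
    proof -
      obtain d where d: "d > 0" "\<And>s y. s \<in> T \<Longrightarrow> s \<le> t \<Longrightarrow> t - d < s \<Longrightarrow> s \<le> y \<Longrightarrow> y < t + d \<Longrightarrow>
          norm (?g y - g t) \<le> e"
        using step_extension_near_right_dense[OF T g e t True] by blast
      have "norm (F s - F t - (s - t) *\<^sub>R g t) \<le> e * norm (s - t)"
        if s: "s \<in> T" "norm (s - t) < d" for s
      proof (cases "s \<le> t")
        case True
        \<comment> \<open>The point s of T is itself the anchor of the estimate; for s > t the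
          anchor is t.\<close>
        have "norm (F t - F s - (t - s) *\<^sub>R g t) \<le> e * (t - s)"
          using d(2)[OF s(1) True] d(1) s True e by (intro approx) auto
        moreover have "F s - F t - (s - t) *\<^sub>R g t = - (F t - F s - (t - s) *\<^sub>R g t)"
          by (simp add: algebra_simps)
        ultimately show ?thesis using True by (simp only: norm_minus_cancel) simp
      next
        case False
        then have "norm (F s - F t - (s - t) *\<^sub>R g t) \<le> e * (s - t)"
          using d(2)[OF t] d(1) s e by (intro approx) auto
        then show ?thesis using False by simp
      qed
      then show ?thesis using d(1) by blast
    qed
    then have "(F has_vector_derivative g t) (at t within T)"
      unfolding has_vector_derivative_def has_derivative_within_alt
      by (simp add: bounded_linear_scaleR_left)
    then show ?thesis by (simp add: has_delta_derivative_right_dense[OF True])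
  next
    case False
    let ?\<sigma> = "forward_jump T t"
    have lt: "t < ?\<sigma>" using right_dense_or_scattered[OF T t] False by blast
    have "(?g has_integral (?\<sigma> - t) *\<^sub>R g t) {t..?\<sigma>}"
    \<comment> \<open>Only the endpoint \<sigma>(t), where the extension may already take a new
      value, has to be discarded.\<close>
    proof (rule has_integral_spike[of "{?\<sigma>}" _ _ "\<lambda>_. g t"])
      show "((\<lambda>_. g t) has_integral (?\<sigma> - t) *\<^sub>R g t) {t..?\<sigma>}"
        using has_integral_const_real[of "g t" t ?\<sigma>] lt by simp
      fix y assume y: "y \<in> {t..?\<sigma>} - {?\<sigma>}"
      have "?g y = ?g t"
        by (rule step_extension_gap) (use y forward_jump_le[OF T t] in force)+
      then show "?g y = g t" by (simp add: step_extension_eq[OF t])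
    qed simp
    then have "F ?\<sigma> - F t = (?\<sigma> - t) *\<^sub>R g t"
      using F[of t ?\<sigma>] lt by (simp add: integral_unique)
    then show ?thesis
      unfolding has_delta_derivative_right_scattered[OF t lt]
      using lt cont[of t] by (simp add: scaleR_conv_of_real continuous_at_imp_continuous_at_within flip: of_real_diff)
  qed
  then show ?thesis using kappa_subset unfolding delta_antiderivative_def by blast
qed

section \<open>The Cayley exponential\<close>

lemma tendsto_Ln_quotient:
  "((\<lambda>u. Ln ((1 + u) / (1 - u)) / u) \<longlongrightarrow> 2) (at (0::complex))"
proof -
  \<comment> \<open>As Ln 1 = 0, the quotient in question is the difference quotient of this
    function at 0.\<close>
  have "((\<lambda>u. Ln ((1 + u) / (1 - u))) has_field_derivative 2) (at (0::complex))"
    by (auto intro!: derivative_eq_intros)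
  then show ?thesis by (simp add: has_field_derivative_iff)
qed

lemma tendsto_cayley_zeta:
  assumes z: "(z \<longlongrightarrow> l) F" and h: "(h \<longlongrightarrow> 0) F"
  shows "((\<lambda>s. cayley_zeta (h s) (z s)) \<longlongrightarrow> l) F"
proof -
  \<comment> \<open>\<open>cayley_zeta h z\<close> is \<open>z / 2\<close> times a function of \<open>z h\<close> that is continuous at 0, also for \<open>h = 0\<close>\<close>
  define q where "q u = (if u = 0 then 2 else Ln ((1 + u) / (1 - u)) / u)" for u :: complex
  have eq: "cayley_zeta h z = z / 2 * q (1/2 * z * complex_of_real h)" for h z
    by (auto simp: cayley_zeta_def q_def)
  have "(q \<longlongrightarrow> 2) (at 0)"
    by (rule Lim_transform_eventually[OF tendsto_Ln_quotient]) (auto simp: eventually_at_filter q_def)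
  then have "isCont q 0" by (simp add: isCont_def q_def)
  moreover have "((\<lambda>s. 1/2 * z s * complex_of_real (h s)) \<longlongrightarrow> 1/2 * l * complex_of_real 0) F"
    by (intro tendsto_intros z h)
  ultimately have "((\<lambda>s. q (1/2 * z s * complex_of_real (h s))) \<longlongrightarrow> q 0) F"
    using isCont_tendsto_compose[of 0 q] by simp
  then have "((\<lambda>s. z s / 2 * q (1/2 * z s * complex_of_real (h s))) \<longlongrightarrow> l / 2 * q 0) F"
    by (intro tendsto_intros z) simp
  then show ?thesis by (simp add: eq q_def)
qed

section \<open>Limits of the graininess and rd-continuity of the integrand\<close>

lemma graininess_nonneg: "time_scale T \<Longrightarrow> t \<in> T \<Longrightarrow> 0 \<le> graininess T t"
  using forward_jump_ge by (simp add: graininess_def)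

lemma graininess_left_bound:
  "time_scale T \<Longrightarrow> s \<in> T \<Longrightarrow> t \<in> T \<Longrightarrow> s < t \<Longrightarrow> graininess T s \<le> t - s"
  using forward_jump_le by (simp add: graininess_def)

text \<open>The jump from s < t cannot pass t, so 0 \<le> \<mu>(s) \<le> t - s.\<close>

lemma tendsto_graininess_left:
  assumes T: "time_scale T" "t \<in> T"
  shows "(graininess T \<longlongrightarrow> 0) (at t within T \<inter> {..<t})"
  unfolding tendsto_iff eventually_at
proof (intro allI impI)
  fix e :: real assume "e > 0"
  then show "\<exists>d>0. \<forall>s\<in>T \<inter> {..<t}. s \<noteq> t \<and> dist s t < d \<longrightarrow> dist (graininess T s) 0 < e"
    using graininess_nonneg[OF T(1)] graininess_left_bound[OF T(1) _ T(2)]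
    by (intro exI[of _ e]) (force simp: dist_real_def)
qed

text \<open>On the left, jumps cannot pass t. On the right, a point r of T slightly beyond t bounds
  every jump that starts between t and r; if t is the maximum, there is nothing to check
  there.\<close>

lemma tendsto_graininess_right_dense:
  assumes T: "time_scale T" "t \<in> T" and rd: "right_dense T t"
  shows "(graininess T \<longlongrightarrow> 0) (at t within T)"
  unfolding tendsto_iff eventually_at
proof (intro allI impI)
  fix e :: real assume e: "e > 0"
  obtain d where d: "d > 0" "\<And>s. s \<in> T \<Longrightarrow> t < s \<Longrightarrow> s < t + d \<Longrightarrow> graininess T s < e"
  proof (cases "\<exists>s\<in>T. t < s")
    case True
    then obtain r where r: "r \<in> T" "t < r" "r < t + e"
      using right_dense_nearby[OF T rd _ _ e] by blast
    show thesis
    proof (rule that[of "r - t"])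
      fix s assume "s \<in> T" "t < s" "s < t + (r - t)"
      then show "graininess T s < e" using graininess_left_bound[OF T(1) _ r(1), of s] r by simp
    qed (use r in simp)
  next
    case False
    then show thesis by (intro that[of 1]) auto
  qed
  have "dist (graininess T s) 0 < e" if s: "s \<in> T" "s \<noteq> t" "dist s t < min d e" for s
  proof (cases "s < t")
    case True
    then show ?thesis
      using graininess_left_bound[OF T(1) s(1) T(2)] graininess_nonneg[OF T(1) s(1)] s
      by (simp add: dist_real_def)
  next
    case False
    then show ?thesis
      using d(2)[OF s(1)] graininess_nonneg[OF T(1) s(1)] s by (simp add: dist_real_def)
  qed
  then show "\<exists>d>0. \<forall>s\<in>T. s \<noteq> t \<and> dist s t < d \<longrightarrow> dist (graininess T s) 0 < e"
    using d(1) e by (intro exI[of _ "min d e"]) simp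
qed

text \<open>In both kinds of limit \<mu> tends to 0, so the integrand has the same limit as
  \<alpha>; at a right-dense point it also has the same value.\<close>

lemma rd_continuous_cayley_zeta:
  assumes T: "time_scale T" and \<alpha>: "rd_continuous T \<alpha>"
  shows "rd_continuous T (\<lambda>s. cayley_zeta (graininess T s) (\<alpha> s))"
  unfolding rd_continuous_def
proof (intro conjI ballI impI)
  fix t assume t: "t \<in> T" "right_dense T t"
  then have "cayley_zeta (graininess T t) (\<alpha> t) = \<alpha> t"
    by (simp add: cayley_zeta_def graininess_def right_dense_def)
  moreover have "(\<alpha> \<longlongrightarrow> \<alpha> t) (at t within T)"
    using \<alpha> t by (simp add: rd_continuous_def continuous_within)
  ultimately show "continuous (at t within T) (\<lambda>s. cayley_zeta (graininess T s) (\<alpha> s))"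
    unfolding continuous_within
    using tendsto_cayley_zeta tendsto_graininess_right_dense[OF T t] by simp
next
  fix t assume t: "t \<in> T" "left_dense T t"
  then obtain l where "(\<alpha> \<longlongrightarrow> l) (at t within T \<inter> {..<t})"
    using \<alpha> unfolding rd_continuous_def by blast
  then show "\<exists>l. ((\<lambda>s. cayley_zeta (graininess T s) (\<alpha> s)) \<longlongrightarrow> l) (at t within T \<inter> {..<t})"
    using tendsto_cayley_zeta[OF _ tendsto_graininess_left[OF T t(1)]] by blast
qed

section \<open>The differential equation of the Cayley exponential\<close>

lemma exp_cayley_zeta:
  assumes h: "h \<noteq> 0" and "complex_of_real h * z \<noteq> 2" "complex_of_real h * z \<noteq> - 2"
  shows "exp (complex_of_real h * cayley_zeta h z) =
    (2 + complex_of_real h * z) / (2 - complex_of_real h * z)"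
proof -
  let ?w = "(1 + 1/2 * z * complex_of_real h) / (1 - 1/2 * z * complex_of_real h)"
  have w: "?w = (2 + complex_of_real h * z) / (2 - complex_of_real h * z)"
    using assms by (simp add: divide_simps) (simp add: algebra_simps)
  \<comment> \<open>Excluding -2 keeps the argument of \<open>Ln\<close> nonzero, so
    \<open>exp\<close> undoes \<open>Ln\<close> whatever the branch; excluding 2 keeps the
    denominator nonzero.\<close>
  have "2 + complex_of_real h * z \<noteq> 0" using assms(3) by (metis add_eq_0_iff)
  then have "?w \<noteq> 0" unfolding w using assms(2) by simp
  then have "exp (complex_of_real h * cayley_zeta h z) = ?w"
    using h by (simp add: cayley_zeta_def exp_Ln)
  then show ?thesis unfolding w .
qed

text \<open>One antiderivative F serves all t, so the exponential can be differentiated through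
  F.\<close>

lemma cayley_exp_eq:
  assumes T: "time_scale T" "0 \<in> T" and \<alpha>: "rd_continuous T \<alpha>"
  obtains F where "\<And>t. t \<in> kappa T \<Longrightarrow> has_delta_derivative T F (cayley_zeta (graininess T t) (\<alpha> t)) t"
    and "\<And>t. t \<in> T \<Longrightarrow> cayley_exp T \<alpha> t = exp (F t - F 0)"
proof -
  obtain F where F: "delta_antiderivative T (\<lambda>s. cayley_zeta (graininess T s) (\<alpha> s)) F"
    using ex_delta_antiderivative[OF T(1) rd_continuous_cayley_zeta[OF T(1) \<alpha>]] by blast
  show thesis
  proof (rule that[of F])
    show "cayley_exp T \<alpha> t = exp (F t - F 0)" if "t \<in> T" for t
      unfolding cayley_exp_def delta_integral_eq[OF T that F] ..
  qed (use F in \<open>simp add: delta_antiderivative_def\<close>)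
qed

lemma cayley_exp_0:
  assumes "time_scale T" "0 \<in> T" "rd_continuous T \<alpha>"
  shows "cayley_exp T \<alpha> 0 = 1"
  using cayley_exp_eq[OF assms] assms(2) by (metis diff_self exp_zero)

lemma has_delta_derivative_cayley_exp:
  assumes T: "time_scale T" "0 \<in> T" and \<alpha>: "regressive T \<alpha>" "rd_continuous T \<alpha>" and t: "t \<in> kappa T"
  shows "has_delta_derivative T (cayley_exp T \<alpha>) (\<alpha> t * jump_average T (cayley_exp T \<alpha>) t) t"
proof -
  obtain F where F: "\<And>t. t \<in> kappa T \<Longrightarrow> has_delta_derivative T F (cayley_zeta (graininess T t) (\<alpha> t)) t"
    and E: "\<And>t. t \<in> T \<Longrightarrow> cayley_exp T \<alpha> t = exp (F t - F 0)"
    using cayley_exp_eq[OF T \<alpha>(2)] by blast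
  have tT: "t \<in> T" using t kappa_subset by blast
  let ?\<sigma> = "forward_jump T t" and ?\<mu> = "graininess T t"
  let ?E = "\<lambda>s. exp (F s - F 0)"
  have avg: "jump_average T (cayley_exp T \<alpha>) t = (?E t + ?E ?\<sigma>) / 2"
    by (simp add: jump_average_def E tT forward_jump_in[OF T(1) tT])
  have "has_delta_derivative T ?E (\<alpha> t * ((?E t + ?E ?\<sigma>) / 2)) t"
    using right_dense_or_scattered[OF T(1) tT]
  proof
    assume rd: "right_dense T t"
    then have \<sigma>: "?\<sigma> = t" and \<mu>: "?\<mu> = 0" by (auto simp: right_dense_def graininess_def)
    have "(F has_vector_derivative \<alpha> t) (at t within T)"
      using F[OF t] by (simp add: has_delta_derivative_right_dense[OF rd] \<mu> cayley_zeta_def)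
    then have "((\<lambda>s. F s - F 0) has_vector_derivative \<alpha> t) (at t within T)"
      by (auto intro!: derivative_eq_intros)
    then have "((exp \<circ> (\<lambda>s. F s - F 0)) has_vector_derivative \<alpha> t * exp (F t - F 0)) (at t within T)"
      by (rule field_vector_diff_chain_within) (auto intro!: derivative_eq_intros)
    then show ?thesis
      by (simp add: has_delta_derivative_right_dense[OF rd] \<sigma> o_def)
  next
    assume sc: "t < ?\<sigma>"
    then have \<mu>: "?\<mu> \<noteq> 0" by (simp add: graininess_def)
    have cont: "continuous (at t within T) F"
      and \<zeta>: "cayley_zeta ?\<mu> (\<alpha> t) = (F ?\<sigma> - F t) / complex_of_real ?\<mu>"
      using F[OF t] unfolding has_delta_derivative_right_scattered[OF tT sc]
      by (auto simp: graininess_def)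
    have reg: "complex_of_real ?\<mu> * \<alpha> t \<noteq> 2" "complex_of_real ?\<mu> * \<alpha> t \<noteq> - 2"
      using \<alpha>(1) t by (auto simp: regressive_def)
    have "F ?\<sigma> - F t = complex_of_real ?\<mu> * cayley_zeta ?\<mu> (\<alpha> t)" using \<zeta> \<mu> by simp
    then have "F ?\<sigma> - F 0 = (F t - F 0) + complex_of_real ?\<mu> * cayley_zeta ?\<mu> (\<alpha> t)"
      by (simp add: algebra_simps)
    then have E\<sigma>: "?E ?\<sigma> = ?E t * ((2 + complex_of_real ?\<mu> * \<alpha> t) / (2 - complex_of_real ?\<mu> * \<alpha> t))"
      by (simp only: exp_add exp_cayley_zeta[OF \<mu> reg])
    have "2 - complex_of_real ?\<mu> * \<alpha> t \<noteq> 0" using reg(1) by simp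
    \<comment> \<open>Both sides equal 2 \<alpha> E / (2 - \<mu> \<alpha>), where E is the value at
      t.\<close>
    then have "\<alpha> t * ((?E t + ?E ?\<sigma>) / 2) = (?E ?\<sigma> - ?E t) / complex_of_real ?\<mu>"
      unfolding E\<sigma> using \<mu> by (simp add: divide_simps) (simp add: algebra_simps)
    moreover have "continuous (at t within T) ?E" by (intro continuous_intros cont)
    ultimately show ?thesis
      unfolding has_delta_derivative_right_scattered[OF tT sc] graininess_def by blast
  qed
  then show ?thesis
    unfolding avg by (rule has_delta_derivative_cong[OF T(1) tT, rotated]) (simp add: E)
qed

text \<open>The two terms of the averaged product rule are a<f><g> and its negative.\<close>

lemma has_delta_derivative_mult_eq_0:
  assumes T: "time_scale T" "t \<in> T"
    and f: "has_delta_derivative T f (a * jump_average T f t) t"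
    and g: "has_delta_derivative T g (- a * jump_average T g t) t"
  shows "has_delta_derivative T (\<lambda>s. f s * g s) 0 t"
  using right_dense_or_scattered[OF T]
proof
  assume rd: "right_dense T t"
  then have "forward_jump T t = t" by (simp add: right_dense_def)
  then have "jump_average T f t = f t" "jump_average T g t = g t"
    by (simp_all add: jump_average_def)
  then have "((\<lambda>s. f s * g s) has_vector_derivative f t * (- a * g t) + a * f t * g t) (at t within T)"
    using f g unfolding has_delta_derivative_right_dense[OF rd]
    by (intro has_vector_derivative_mult) simp_all
  then show ?thesis unfolding has_delta_derivative_right_dense[OF rd] by (simp add: algebra_simps)
next
  let ?\<sigma> = "forward_jump T t"
  assume sc: "t < ?\<sigma>"
  define m where "m = complex_of_real (?\<sigma> - t)"
  have m: "m \<noteq> 0" using sc by (simp add: m_def)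
  have cont: "continuous (at t within T) f" "continuous (at t within T) g"
    and "a * jump_average T f t = (f ?\<sigma> - f t) / m" "- a * jump_average T g t = (g ?\<sigma> - g t) / m"
    using f g unfolding has_delta_derivative_right_scattered[OF T(2) sc] m_def by auto
  then have d: "f ?\<sigma> - f t = m * a / 2 * (f ?\<sigma> + f t)" "g ?\<sigma> - g t = - (m * a / 2 * (g ?\<sigma> + g t))"
    using m by (simp_all add: jump_average_def field_simps)
  \<comment> \<open>Product rule across a jump; the factor 2 clears the denominators of the
    averages.\<close>
  have "2 * (f ?\<sigma> * g ?\<sigma> - f t * g t) =
      (f ?\<sigma> - f t) * (g ?\<sigma> + g t) + (f ?\<sigma> + f t) * (g ?\<sigma> - g t)"
    by (simp add: algebra_simps)
  also have "\<dots> = 0" unfolding d by (simp add: algebra_simps)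
  finally have "f ?\<sigma> * g ?\<sigma> - f t * g t = 0" by simp
  then show ?thesis
    unfolding has_delta_derivative_right_scattered[OF T(2) sc]
    using cont by (auto intro!: continuous_intros)
qed

section \<open>The product of the exponentials of \<alpha> and -\<alpha>\<close>

lemma regressive_minus: "regressive T \<alpha> \<Longrightarrow> regressive T (\<lambda>s. - \<alpha> s)"
  by (auto simp: regressive_def minus_equation_iff)

lemma rd_continuous_minus: "rd_continuous T \<alpha> \<Longrightarrow> rd_continuous T (\<lambda>s. - \<alpha> s)"
  unfolding rd_continuous_def by (blast intro: continuous_minus tendsto_minus)

lemma cayley_exp_mult_minus:
  assumes T: "time_scale T" "0 \<in> T" and \<alpha>: "regressive T \<alpha>" "rd_continuous T \<alpha>" and t: "t \<in> T"
  shows "cayley_exp T \<alpha> t * cayley_exp T (\<lambda>s. - \<alpha> s) t = 1"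
proof -
  let ?P = "\<lambda>s. cayley_exp T \<alpha> s * cayley_exp T (\<lambda>s. - \<alpha> s) s"
  have "has_delta_derivative T ?P 0 s" if "s \<in> kappa T" for s
  proof (rule has_delta_derivative_mult_eq_0[OF T(1), where a = "\<alpha> s"])
    show "s \<in> T" using that kappa_subset by blast
  qed (intro has_delta_derivative_cayley_exp T \<alpha> that regressive_minus rd_continuous_minus)+
  then have "?P t = ?P 0" by (rule delta_derivative_zero_imp_eq[OF T(1) t T(2)])
  then show ?thesis by (simp add: cayley_exp_0 T \<alpha> rd_continuous_minus)
qed

theorem theorem3p19:
  fixes T :: "real set" and \<alpha> :: "real \<Rightarrow> complex"
  assumes "time_scale T" and "0 \<in> T"
    and "regressive T \<alpha>" and "rd_continuous T \<alpha>"
  shows "(\<forall>t\<in>T. (cayley_cosh T \<alpha> t)\<^sup>2 - (cayley_sinh T \<alpha> t)\<^sup>2 = 1) \<and>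
         (\<forall>t\<in>kappa T.
            has_delta_derivative T (cayley_cosh T \<alpha>)
              (\<alpha> t * jump_average T (cayley_sinh T \<alpha>) t) t \<and>
            has_delta_derivative T (cayley_sinh T \<alpha>)
              (\<alpha> t * jump_average T (cayley_cosh T \<alpha>) t) t)"
proof (intro conjI ballI)
  let ?E = "cayley_exp T \<alpha>" and ?E' = "cayley_exp T (\<lambda>s. - \<alpha> s)"
  \<comment> \<open>The factor 1/2 stands in front so that the rule for constant multiples
    applies.\<close>
  have cosh_eq: "cayley_cosh T \<alpha> = (\<lambda>s. 1/2 * (?E s + ?E' s))"
    and sinh_eq: "cayley_sinh T \<alpha> = (\<lambda>s. 1/2 * (?E s - ?E' s))"
    by (auto simp: cayley_cosh_def cayley_sinh_def)
  {
    fix t assume "t \<in> T"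
    \<comment> \<open>Half sum squared minus half difference squared is the product.\<close>
    have "(cayley_cosh T \<alpha> t)\<^sup>2 - (cayley_sinh T \<alpha> t)\<^sup>2 = ?E t * ?E' t"
      by (simp add: cosh_eq sinh_eq power2_eq_square field_simps)
    then show "(cayley_cosh T \<alpha> t)\<^sup>2 - (cayley_sinh T \<alpha> t)\<^sup>2 = 1"
      using cayley_exp_mult_minus[OF assms \<open>t \<in> T\<close>] by simp
  }
  fix t assume t: "t \<in> kappa T"
  note E = has_delta_derivative_cayley_exp[OF assms t]
  note E' = has_delta_derivative_cayley_exp
    [OF assms(1,2) regressive_minus[OF assms(3)] rd_continuous_minus[OF assms(4)] t]
  \<comment> \<open>The derivative of \<open>?E'\<close> carries the sign of -\<alpha>, which turns
    the sum of exponentials into their difference.\<close>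
  have *: "\<alpha> t * jump_average T (cayley_sinh T \<alpha>) t =
      1/2 * (\<alpha> t * jump_average T ?E t + - \<alpha> t * jump_average T ?E' t)"
    by (simp add: jump_average_def sinh_eq field_simps)
  show "has_delta_derivative T (cayley_cosh T \<alpha>) (\<alpha> t * jump_average T (cayley_sinh T \<alpha>) t) t"
    unfolding * unfolding cosh_eq
    by (rule has_delta_derivative_cmult[OF has_delta_derivative_add[OF E E']])
  have *: "\<alpha> t * jump_average T (cayley_cosh T \<alpha>) t =
      1/2 * (\<alpha> t * jump_average T ?E t - - \<alpha> t * jump_average T ?E' t)"
    by (simp add: jump_average_def cosh_eq field_simps)
  show "has_delta_derivative T (cayley_sinh T \<alpha>) (\<alpha> t * jump_average T (cayley_cosh T \<alpha>) t) t"
    unfolding * unfolding sinh_eq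
    by (rule has_delta_derivative_cmult[OF has_delta_derivative_diff[OF E E']])
qed

end
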